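(* Let $G$ be a connected $3K_1$-free graph and $u\in V(G)$. Then $G$ has a Hamiltonian path starting at $u$ if and only if $u$ is not an articulation point of $G$.
   Context: Graphs are finite, simple and undirected. $3K_1$-free means no independent set of size 3. An articulation point is a vertex $x$ such that $G-\{x\}$ is disconnected. A Hamiltonian path is a path containing all vertices of $G$. *)

theory Defs
  imports "Graph_Theory.Graph_Theory"
begin

(* The locale predicate graph describes finite simple undirected graphs: finite, loop-free
   digraphs without parallel arcs whose adjacency relation arcs_ends is symmetric. *)

definition independent_set :: "('a, 'b) pre_digraph \<Rightarrow> 'a set \<Rightarrow> bool" where
  "independent_set G S \<longleftrightarrow>
     S \<subseteq> verts G \<and> (\<forall>x\<in>S. \<forall>y\<in>S. x \<noteq> y \<longrightarrow> (x, y) \<notin> arcs_ends G)"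

definition three_K1_free :: "('a, 'b) pre_digraph \<Rightarrow> bool" where
  "three_K1_free G \<longleftrightarrow> \<not> (\<exists>S. independent_set G S \<and> card S = 3)"

(* The library predicate connected is false for the null graph. The null graph must not count
   as disconnected, since otherwise the vertex of the one-vertex graph would be an
   articulation point. *)
definition disconnected :: "('a, 'b) pre_digraph \<Rightarrow> bool" where
  "disconnected G \<longleftrightarrow> verts G \<noteq> {} \<and> \<not> connected G"

definition articulation_point :: "('a, 'b) pre_digraph \<Rightarrow> 'a \<Rightarrow> bool" where
  "articulation_point G x \<longleftrightarrow> x \<in> verts G \<and> disconnected (pre_digraph.del_vert G x)"

(* The empty arc list is the one-vertex path: awalk_verts u [] = [u]. *)
definition hamiltonian_path :: "('a, 'b) pre_digraph \<Rightarrow> 'a \<Rightarrow> 'b awalk \<Rightarrow> 'a \<Rightarrow> bool" where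
  "hamiltonian_path G u p v \<longleftrightarrow>
     pre_digraph.apath G u p v \<and> set (pre_digraph.awalk_verts G u p) = verts G"

end

(* A Hamiltonian path from u leaves a path through all of G - u. Conversely, the path is grown by
   induction on the vertex set: if H = G - u is connected, then u has a neighbour that is not an
   articulation point of H, and the path continues from there. *)
theory Submission
  imports Defs
begin

text \<open>Connectedness as a cut condition on vertex sets inside the fixed graph \<open>G\<close>,
  so that inductions can drop vertices without forming subgraphs. It is vacuous for the empty set,
  in line with the null graph not counting as disconnected.\<close>

definition cut_connected :: "('a, 'b) pre_digraph \<Rightarrow> 'a set \<Rightarrow> bool" where
  "cut_connected G A \<longleftrightarrow> (\<forall>X. X \<subset> A \<longrightarrow> X \<noteq> {} \<longrightarrow> (\<exists>x\<in>X. \<exists>y\<in>A - X. x \<rightarrow>\<^bsub>G\<^esub> y))"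

lemma (in sym_digraph) adj_sym: "x \<rightarrow>\<^bsub>G\<^esub> y \<Longrightarrow> y \<rightarrow>\<^bsub>G\<^esub> x"
  using arcs_ends_symmetric[OF sym_arcs] .

text \<open>A set that no edge leaves keeps everything reachable from its elements. Conversely, no
  edge leaves the set reachable from a vertex, so the cut condition forces it to be all of
  \<open>verts G\<close>.\<close>

lemma (in sym_digraph) connected_iff_cut_connected:
  "connected G \<longleftrightarrow> verts G \<noteq> {} \<and> cut_connected G (verts G)"
proof -
  have "connected G \<longleftrightarrow> verts G \<noteq> {} \<and> (\<forall>x\<in>verts G. \<forall>y\<in>verts G. x \<rightarrow>\<^sup>*\<^bsub>G\<^esub> y)"
    by (simp add: connected_def strongly_connected_def reachable_mk_symmetric_eq[OF sym_arcs])
  also have "(\<forall>x\<in>verts G. \<forall>y\<in>verts G. x \<rightarrow>\<^sup>*\<^bsub>G\<^esub> y) \<longleftrightarrow> cut_connected G (verts G)"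
  proof
    assume reach: "\<forall>x\<in>verts G. \<forall>y\<in>verts G. x \<rightarrow>\<^sup>*\<^bsub>G\<^esub> y"
    show "cut_connected G (verts G)"
      unfolding cut_connected_def
    proof (intro allI impI, rule ccontr)
      fix X assume X: "X \<subset> verts G" "X \<noteq> {}" "\<not> (\<exists>x\<in>X. \<exists>y\<in>verts G - X. x \<rightarrow>\<^bsub>G\<^esub> y)"
      then obtain x y where xy: "x \<in> X" "y \<in> verts G - X" by blast
      with X(1) reach have "x \<rightarrow>\<^sup>*\<^bsub>G\<^esub> y" by blast
      then have "y \<in> X"
        by (induction rule: reachable_induct) (use xy X(3) adj_in_verts in blast)+
      with xy show False by blast
    qed
  next
    assume cut: "cut_connected G (verts G)"
    show "\<forall>x\<in>verts G. \<forall>y\<in>verts G. x \<rightarrow>\<^sup>*\<^bsub>G\<^esub> y"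
    proof (rule ballI)
      fix x assume x: "x \<in> verts G"
      let ?R = "{y. x \<rightarrow>\<^sup>*\<^bsub>G\<^esub> y}"
      have "?R \<subseteq> verts G" "?R \<noteq> {}"
        using x by (auto dest: reachable_in_verts)
      moreover have "\<not> (\<exists>z\<in>?R. \<exists>y\<in>verts G - ?R. z \<rightarrow>\<^bsub>G\<^esub> y)"
        by (auto dest: reachable_adj_trans)
      ultimately have "?R = verts G"
        using cut unfolding cut_connected_def by blast
      then show "\<forall>y\<in>verts G. x \<rightarrow>\<^sup>*\<^bsub>G\<^esub> y" by blast
    qed
  qed
  finally show ?thesis .
qed

text \<open>Deleting \<open>u\<close> keeps all adjacencies among the other vertices, so the
  crossing edges are the same. If \<open>u\<close> is the only vertex, both sides are false.\<close>

lemma (in sym_digraph) articulation_point_iff: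
  assumes "u \<in> verts G"
  shows "articulation_point G u \<longleftrightarrow> \<not> cut_connected G (verts G - {u})"
proof -
  have adj: "x \<rightarrow>\<^bsub>del_vert u\<^esub> y \<longleftrightarrow> x \<rightarrow>\<^bsub>G\<^esub> y \<and> x \<noteq> u \<and> y \<noteq> u" for x y
    by (auto simp: arcs_ends_conv del_vert_simps)
  have "symmetric (del_vert u)"
    unfolding symmetric_def by (rule symI) (use adj adj_sym in blast)
  then interpret D: sym_digraph "del_vert u"
    by (rule wf_digraph.sym_digraphI[OF wf_digraph_del_vert])
  have "(\<exists>x\<in>X. \<exists>y\<in>verts G - {u} - X. x \<rightarrow>\<^bsub>del_vert u\<^esub> y) \<longleftrightarrow>
      (\<exists>x\<in>X. \<exists>y\<in>verts G - {u} - X. x \<rightarrow>\<^bsub>G\<^esub> y)" if "X \<subset> verts G - {u}" for X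
    using that by (intro bex_cong refl) (auto simp: adj)
  then have "cut_connected (del_vert u) (verts G - {u}) \<longleftrightarrow> cut_connected G (verts G - {u})"
    unfolding cut_connected_def by simp
  then have "articulation_point G u \<longleftrightarrow> verts G - {u} \<noteq> {} \<and> \<not> cut_connected G (verts G - {u})"
    by (auto simp: articulation_point_def disconnected_def D.connected_iff_cut_connected
        verts_del_vert assms)
  moreover have "cut_connected G (verts G - {u})" if "verts G - {u} = {}"
    unfolding that by (simp add: cut_connected_def)
  ultimately show ?thesis by blast
qed

text \<open>A cut that splits \<open>A\<close> is crossed by an edge inside \<open>A\<close>; any
  other cut separates \<open>x\<close> from all of \<open>A\<close>, and the edge between
  \<open>x\<close> and \<open>a\<close> crosses it.\<close>

lemma (in sym_digraph) cut_connected_insert: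
  assumes "cut_connected G A" "a \<in> A" "x \<rightarrow>\<^bsub>G\<^esub> a"
  shows "cut_connected G (insert x A)"
  unfolding cut_connected_def
proof (intro allI impI)
  fix X assume X: "X \<subset> insert x A" "X \<noteq> {}"
  show "\<exists>y\<in>X. \<exists>z\<in>insert x A - X. y \<rightarrow>\<^bsub>G\<^esub> z"
  proof (cases "X \<inter> A = {} \<or> A \<subseteq> X")
    case True
    then have "X = {x} \<and> x \<notin> A \<or> X = A"
      using X by blast
    then show ?thesis
      using X assms(2,3) adj_sym by blast
  next
    case False
    then have "X \<inter> A \<subset> A" "X \<inter> A \<noteq> {}" by auto
    then obtain y z where "y \<in> X \<inter> A" "z \<in> A - X \<inter> A" "y \<rightarrow>\<^bsub>G\<^esub> z"
      using assms(1) unfolding cut_connected_def by blast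
    then show ?thesis by blast
  qed
qed

text \<open>A cut with \<open>w\<close> on one side has some \<open>z\<close> on the other, and one
  edge of the short path from \<open>z\<close> to \<open>w\<close> inside \<open>B\<close> must
  cross it.\<close>

lemma (in sym_digraph) cut_connected_radius_two:
  assumes "w \<in> B"
    and "\<And>z. z \<in> B \<Longrightarrow> z = w \<or> z \<rightarrow>\<^bsub>G\<^esub> w \<or> (\<exists>c\<in>B. z \<rightarrow>\<^bsub>G\<^esub> c \<and> c \<rightarrow>\<^bsub>G\<^esub> w)"
  shows "cut_connected G B"
  unfolding cut_connected_def
proof (intro allI impI)
  fix X assume X: "X \<subset> B" "X \<noteq> {}"
  show "\<exists>x\<in>X. \<exists>y\<in>B - X. x \<rightarrow>\<^bsub>G\<^esub> y"
  proof (cases "w \<in> X")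
    case True
    obtain t where t: "t \<in> B" "t \<notin> X" using X by blast
    with True assms(2)[of t] show ?thesis by (metis DiffI adj_sym)
  next
    case False
    obtain t where "t \<in> X" "t \<in> B" using X by blast
    with False assms(1) assms(2)[of t] show ?thesis by (metis DiffI)
  qed
qed

text \<open>Built from the far end: each arc attaches its tail to the first vertex of the remaining
  walk.\<close>

lemma (in sym_digraph) cut_connected_awalk_verts:
  assumes "awalk u p v"
  shows "cut_connected G (set (awalk_verts u p))"
  using assms
proof (induction p arbitrary: u)
  case Nil
  then show ?case by (auto simp: cut_connected_def)
next
  case (Cons e p)
  then have "e \<in> arcs G" "awalk (head G e) p v" "tail G e = u"
    by (auto simp: awalk_Cons_iff)
  moreover from this have "u \<rightarrow>\<^bsub>G\<^esub> head G e"
    by (auto simp: arcs_ends_conv)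
  ultimately show ?case
    using cut_connected_insert[OF Cons.IH hd_in_awalk_verts(1)] by simp
qed

lemma three_K1_freeD:
  assumes "three_K1_free G" "sym_digraph G" "x \<in> verts G" "y \<in> verts G" "z \<in> verts G"
    "x \<noteq> y" "x \<noteq> z" "y \<noteq> z"
  shows "x \<rightarrow>\<^bsub>G\<^esub> y \<or> x \<rightarrow>\<^bsub>G\<^esub> z \<or> y \<rightarrow>\<^bsub>G\<^esub> z"
proof (rule ccontr)
  assume "\<not> ?thesis"
  then have "independent_set G {x, y, z}"
    using assms(3-5) sym_digraph.adj_sym[OF assms(2)] by (auto simp: independent_set_def)
  moreover have "card {x, y, z} = 3" using assms(6-8) by simp
  ultimately show False using assms(1) unfolding three_K1_free_def by blast
qed

text \<open>If a neighbour \<open>w\<close> of \<open>u\<close> separates \<open>H\<close>, then \<open>H - {w}\<close> consists of two cliques without edges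
  between them, and \<open>u\<close> is adjacent to all of one of them. That clique has a vertex whose removal
  leaves everything within distance two of \<open>w\<close>.\<close>
lemma (in sym_digraph) non_separating_neighbour:
  assumes free: "three_K1_free G"
    and H: "H \<subseteq> verts G" "cut_connected G H"
    and u: "u \<in> verts G" "u \<notin> H"
    and w: "w \<in> H" "u \<rightarrow>\<^bsub>G\<^esub> w"
  shows "\<exists>a\<in>H. u \<rightarrow>\<^bsub>G\<^esub> a \<and> cut_connected G (H - {a})"
proof (cases "cut_connected G (H - {w})")
  case True
  with w show ?thesis by blast
next
  case False
  then obtain X where X: "X \<subset> H - {w}" "X \<noteq> {}"
    "\<And>x y. x \<in> X \<Longrightarrow> y \<in> H - {w} - X \<Longrightarrow> \<not> x \<rightarrow>\<^bsub>G\<^esub> y"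
    unfolding cut_connected_def by blast
  define Y where "Y = H - {w} - X"
  have split: "H = insert w (X \<union> Y)" "w \<notin> X" "w \<notin> Y" "X \<inter> Y = {}" "X \<noteq> {}" "Y \<noteq> {}"
    using X w unfolding Y_def by auto
  have no_edge: "\<not> x \<rightarrow>\<^bsub>G\<^esub> y" "\<not> y \<rightarrow>\<^bsub>G\<^esub> x" if "x \<in> X" "y \<in> Y" for x y
    using X(3) that adj_sym unfolding Y_def by blast+
  \<comment> \<open>Stated for generic \<open>S\<close> and \<open>T\<close> because either
    \<open>X\<close> or \<open>Y\<close> may be the side that lies entirely in the neighbourhood of
    \<open>u\<close>.\<close>
  have clique_side: "\<exists>a\<in>H. u \<rightarrow>\<^bsub>G\<^esub> a \<and> cut_connected G (H - {a})"
    if S: "H = insert w (S \<union> T)" "w \<notin> S" "w \<notin> T" "S \<inter> T = {}" "S \<noteq> {}" "T \<noteq> {}"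
      and no: "\<And>x y. x \<in> S \<Longrightarrow> y \<in> T \<Longrightarrow> \<not> x \<rightarrow>\<^bsub>G\<^esub> y \<and> \<not> y \<rightarrow>\<^bsub>G\<^esub> x"
      and nb: "\<And>x. x \<in> S \<Longrightarrow> u \<rightarrow>\<^bsub>G\<^esub> x" for S T
  proof -
    obtain s\<^sub>0 t\<^sub>0 where s\<^sub>0: "s\<^sub>0 \<in> S" and t\<^sub>0: "t\<^sub>0 \<in> T" using S(5,6) by blast
    have V: "S \<subseteq> verts G" "T \<subseteq> verts G" using S(1) H(1) by blast+
    \<comment> \<open>Two nonadjacent vertices of \<open>S\<close> would form an independent triple
      with \<open>t\<^sub>0\<close>.\<close>
    have cliqueS: "x \<rightarrow>\<^bsub>G\<^esub> y" if "x \<in> S" "y \<in> S" "x \<noteq> y" for x y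
      using three_K1_freeD[OF free sym_digraph_axioms, of x y t\<^sub>0]
        that no t\<^sub>0 S(4) V by blast
    have cliqueT: "x \<rightarrow>\<^bsub>G\<^esub> y" if "x \<in> T" "y \<in> T" "x \<noteq> y" for x y
      using three_K1_freeD[OF free sym_digraph_axioms, of x y s\<^sub>0]
        that no s\<^sub>0 S(4) V by blast
    have "S \<subset> H" "T \<subset> H" using S by blast+
    \<comment> \<open>Some edge of \<open>H\<close> leaves each side, and it can only end in
      \<open>w\<close>, since no edge joins \<open>S\<close> and \<open>T\<close>.\<close>
    then obtain s s' t t' where
      "s \<in> S" "s' \<in> H - S" "s \<rightarrow>\<^bsub>G\<^esub> s'" and "t \<in> T" "t' \<in> H - T" "t \<rightarrow>\<^bsub>G\<^esub> t'"
      using H(2) S(5,6) unfolding cut_connected_def by meson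
    then have st: "s \<in> S" "s \<rightarrow>\<^bsub>G\<^esub> w" "t \<in> T" "t \<rightarrow>\<^bsub>G\<^esub> w" using S(1) no by blast+
    \<comment> \<open>Removing \<open>a\<close> must not cut the rest of \<open>S\<close> off from
      \<open>w\<close>: either \<open>s\<close> survives as the link, or nothing of \<open>S\<close>
      is left.\<close>
    obtain a where a: "a \<in> S" "S = {a} \<or> a \<noteq> s" using st(1) by blast
    have "cut_connected G (H - {a})"
    proof (rule cut_connected_radius_two)
      show "w \<in> H - {a}" using w a S(2) by blast
      fix z assume z: "z \<in> H - {a}"
      then consider "z = w" | "z \<in> S" "a \<noteq> s" | "z \<in> T" using S(1) a by blast
      then show "z = w \<or> z \<rightarrow>\<^bsub>G\<^esub> w \<or> (\<exists>c\<in>H - {a}. z \<rightarrow>\<^bsub>G\<^esub> c \<and> c \<rightarrow>\<^bsub>G\<^esub> w)"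
      proof cases
        case 2
        then show ?thesis using cliqueS[of z s] st S(1) by blast
      next
        case 3
        then show ?thesis using cliqueT[of z t] st S(1,4) a by blast
      qed simp
    qed
    with a nb S(1) show ?thesis by blast
  qed
  have "u \<rightarrow>\<^bsub>G\<^esub> x \<or> u \<rightarrow>\<^bsub>G\<^esub> y" if "x \<in> X" "y \<in> Y" for x y
    using three_K1_freeD[OF free sym_digraph_axioms, of u x y] that no_edge split H(1) u by blast
  \<comment> \<open>If \<open>u\<close> misses some vertex of \<open>X\<close>, it must be adjacent
    to every vertex of \<open>Y\<close>.\<close>
  then consider "\<And>x. x \<in> X \<Longrightarrow> u \<rightarrow>\<^bsub>G\<^esub> x" | "\<And>y. y \<in> Y \<Longrightarrow> u \<rightarrow>\<^bsub>G\<^esub> y" by blast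
  then show ?thesis
  proof cases
    case 1
    show ?thesis by (rule clique_side[of X Y]) (use split no_edge 1 in blast)+
  next
    case 2
    show ?thesis by (rule clique_side[of Y X]) (use split no_edge 2 in blast)+
  qed
qed

text \<open>Asking for connectedness both with and without \<open>u\<close> makes the induction
  close: for the set \<open>A - {u}\<close> and the next vertex \<open>a\<close>, the two conditions
  concern \<open>A - {u}\<close> and \<open>A - {u} - {a}\<close>.\<close>

lemma (in sym_digraph) spanning_apath_from:
  assumes "three_K1_free G" "finite A" "A \<subseteq> verts G" "u \<in> A"
    "cut_connected G A" "cut_connected G (A - {u})"
  shows "\<exists>p v. apath u p v \<and> set (awalk_verts u p) = A"
  using assms(2-)
proof (induction A arbitrary: u rule: finite_psubset_induct)
  case (psubset A)
  show ?case
  proof (cases "A = {u}")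
    case True
    then have "apath u [] u" "set (awalk_verts u []) = A"
      using psubset.prems by (auto simp: apath_Nil_iff)
    then show ?thesis by blast
  next
    case False
    then have "{u} \<subset> A" using psubset.prems(2) by blast
    \<comment> \<open>The cut \<open>{u}\<close> of \<open>A\<close> yields some neighbour; it may
      separate \<open>A - {u}\<close>, so it is then exchanged for \<open>a\<close>.\<close>
    then obtain w where w: "w \<in> A - {u}" "u \<rightarrow>\<^bsub>G\<^esub> w"
      using psubset.prems(3)[unfolded cut_connected_def, rule_format, of "{u}"] by blast
    obtain a where a: "a \<in> A - {u}" "u \<rightarrow>\<^bsub>G\<^esub> a" "cut_connected G (A - {u} - {a})"
      using non_separating_neighbour[OF assms(1) _ psubset.prems(4) _ _ w] psubset.prems(1,2)
      by auto
    obtain p v where p: "apath a p v" "set (awalk_verts a p) = A - {u}"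
      using psubset.IH[of "A - {u}" a] psubset.prems(1,2,4) a(1,3) by auto
    obtain e where e: "e \<in> arcs G" "tail G e = u" "head G e = a"
      using a(2) by (rule reachableE)
    with p psubset.prems(2) have "apath u (e # p) v" "set (awalk_verts u (e # p)) = A"
      by (simp_all add: apath_Cons_iff insert_absorb)
    then show ?thesis by blast
  qed
qed

theorem theorem9:
  fixes G :: "('a, 'b) pre_digraph" and u :: 'a
  assumes "graph G"
    and "connected G"
    and "three_K1_free G"
    and "u \<in> verts G"
  shows "(\<exists>p v. hamiltonian_path G u p v) \<longleftrightarrow> \<not> articulation_point G u"
proof -
  interpret graph G by fact
  show ?thesis
    unfolding articulation_point_iff[OF assms(4)] not_not
  proof
    assume "\<exists>p v. hamiltonian_path G u p v"
    then obtain p v where p: "apath u p v" "set (awalk_verts u p) = verts G"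
      unfolding hamiltonian_path_def by blast
    show "cut_connected G (verts G - {u})"
    proof (cases p)
      case Nil
      with p have "verts G - {u} = {}" by auto
      then show ?thesis unfolding cut_connected_def by blast
    next
      case (Cons e q)
      \<comment> \<open>As the path is simple, \<open>u\<close> does not recur in \<open>q\<close>,
        so the rest covers exactly the other vertices.\<close>
      with p have "awalk (head G e) q v" "set (awalk_verts (head G e) q) = verts G - {u}"
        unfolding Cons apath_Cons_iff by (auto simp: apath_def)
      then show ?thesis using cut_connected_awalk_verts by metis
    qed
  next
    assume "cut_connected G (verts G - {u})"
    then show "\<exists>p v. hamiltonian_path G u p v"
      using spanning_apath_from[OF assms(3) finite_verts subset_refl assms(4)] assms(2)
      by (simp add: hamiltonian_path_def connected_iff_cut_connected)
  qed
qed

end
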